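(* Assume $a>0$, $z>0$, $\sigma^2>0$, a common positive posterior-mean sequence $(m_t)_{t\ge s}$, and positive price denominators along both conditional paths. Let the fresh and inherited myopic price rules use the radii $z\sqrt v$ and $zv/\sqrt{v_s}$ respectively, i.e. $$p_t^F(v)=\Pi_{[\underline p,\bar p]}\!\left(\frac{a}{2(m_t+z\sqrt v)}\right),\qquad p_t^I(v)=\Pi_{[\underline p,\bar p]}\!\left(\frac{a}{2(m_t+zv/\sqrt{v_s})}\right).$$ Starting from the common variance $v_s^F=v_s^I=v_s>0$, the conditional recursions $$v_{t+1}^F=\frac{v_t^F}{1+v_t^F\,p_t^F(v_t^F)^2/\sigma^2},\qquad v_{t+1}^I=\frac{v_t^I}{1+v_t^I\,p_t^I(v_t^I)^2/\sigma^2}$$ satisfy $$v_t^F\ge v_t^I,\qquad p_t^F(v_t^F)\le p_t^I(v_t^I)\qquad\text{for all later dates } t.$$ A strict feasible price gap $p_t^F(v_t^F)<p_t^I(v_t^I)$ gives a strict next-period variance gap $v_{t+1}^F>v_{t+1}^I$. Hence fresh reconstruction can lower price, reduce Fisher information, and preserve the variance that sustains future ambiguity.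
   Context: Prices lie in $[\underline p,\bar p]$ with $0\le\underline p<\bar p<\infty$, and $\Pi_{[\underline p,\bar p]}$ is projection onto this interval. The setting is demand $Y_{t+1}=a-\theta p_t+\varepsilon_{t+1}$, $\varepsilon_{t+1}\sim N(0,\sigma^2)$, with Gaussian belief $\theta\sim N(m_t,v_t)$, whose posterior variance obeys $v_{t+1}^{-1}=v_t^{-1}+p_t^2/\sigma^2$ (Fisher information of price $p$ is $p^2/\sigma^2$). $s$ is the initial vintage date. The comparison is conditional: the same sequence $m_t>0$ is used in both recursions. *)

theory Defs
  imports "HOL-Analysis.Analysis"
begin

definition fresh_radius :: "real \<Rightarrow> real \<Rightarrow> real" where
  "fresh_radius z v = z * sqrt v"

definition inherited_radius :: "real \<Rightarrow> real \<Rightarrow> real \<Rightarrow> real" where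
  "inherited_radius z vs v = z * v / sqrt vs"

(* m is the posterior mean, r the ambiguity radius; the projection onto the feasible
   interval is the library's metric projection. *)
definition myopic_price :: "real \<Rightarrow> real \<Rightarrow> real \<Rightarrow> real \<Rightarrow> real \<Rightarrow> real" where
  "myopic_price plo phi a m r = closest_point {plo..phi} (a / (2 * (m + r)))"

definition fresh_price :: "real \<Rightarrow> real \<Rightarrow> real \<Rightarrow> real \<Rightarrow> real \<Rightarrow> real \<Rightarrow> real" where
  "fresh_price plo phi a z m v = myopic_price plo phi a m (fresh_radius z v)"

definition inherited_price ::
  "real \<Rightarrow> real \<Rightarrow> real \<Rightarrow> real \<Rightarrow> real \<Rightarrow> real \<Rightarrow> real \<Rightarrow> real" where
  "inherited_price plo phi a z vs m v = myopic_price plo phi a m (inherited_radius z vs v)"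

(* Information about the slope theta in one observation Y ~ N(a - theta * p, sigma^2). *)
definition fisher_info :: "real \<Rightarrow> real \<Rightarrow> real" where
  "fisher_info \<sigma> p = p\<^sup>2 / \<sigma>\<^sup>2"

(* The posterior variance is updated by adding the information p^2 / sigma^2 to the
   precision 1 / v, solved here for the new variance. *)
definition next_var :: "real \<Rightarrow> real \<Rightarrow> real \<Rightarrow> real" where
  "next_var \<sigma> v p = v / (1 + v * p\<^sup>2 / \<sigma>\<^sup>2)"

(* Both recursions are driven by one and the same mean sequence m: the comparison is
   conditional on it.  Values of m, vF and vI before the vintage date s are irrelevant. *)
locale conditional_paths =
  fixes plo phi a z \<sigma> :: real
    and s :: nat
    and m :: "nat \<Rightarrow> real"
    and vs :: real
    and vF vI :: "nat \<Rightarrow> real"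
  assumes price_bounds: "0 \<le> plo" "plo < phi"
    and a_pos: "a > 0"
    and z_pos: "z > 0"
    and noise_var_pos: "\<sigma>\<^sup>2 > 0"
    and m_pos: "\<forall>t\<ge>s. m t > 0"
    and vs_pos: "vs > 0"
    and denomF_pos: "\<forall>t\<ge>s. 2 * (m t + fresh_radius z (vF t)) > 0"
    and denomI_pos: "\<forall>t\<ge>s. 2 * (m t + inherited_radius z vs (vI t)) > 0"
    and initF: "vF s = vs"
    and initI: "vI s = vs"
    and recF: "\<forall>t\<ge>s. vF (Suc t) = next_var \<sigma> (vF t) (fresh_price plo phi a z (m t) (vF t))"
    and recI: "\<forall>t\<ge>s. vI (Suc t) = next_var \<sigma> (vI t) (inherited_price plo phi a z vs (m t) (vI t))"

end

theory Submission
  imports Defs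
begin

text \<open>
  As long as the current variance \<open>v\<close> has not risen above the vintage variance \<open>v\<^sub>s\<close>, the
  inherited radius \<open>z v / sqrt v\<^sub>s = z sqrt v * sqrt (v / v\<^sub>s)\<close> is at most the fresh radius
  \<open>z sqrt v\<close>.  A larger radius means a lower price, because the unconstrained price decreases in
  the radius and projection onto an interval is monotone.  A lower nonnegative price carries less
  Fisher information, and the variance update increases in the old variance and decreases in the
  price: in terms of precisions it is \<open>1/v \<mapsto> 1/v + p\<^sup>2/\<sigma>\<^sup>2\<close>.  So the chain
  \<open>0 < v\<^sup>I \<le> v\<^sup>F \<le> v\<^sub>s\<close> reproduces itself from one date to the next, and the price
  comparison comes with it.  Its upper end holds because observation never raises the variance.

  The strict statements follow from the strict form of the same monotonicity.  For the existence
  claim it is enough to exhibit one path with a strict price gap.  At the vintage date the two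
  radii coincide, so the gap can first occur one date later; by then a positive price has
  pushed the common variance strictly below \<open>v\<^sub>s\<close>, the radii differ, and the prices differ as
  well if the price bounds do not bind.
\<close>

section \<open>Monotonicity of the price, the information and the variance update\<close>

lemma closest_point_interval_real:
  fixes l u x :: real
  assumes "l \<le> u"
  shows "closest_point {l..u} x = max l (min u x)"
proof -
  have "max l (min u x) = closest_point {l..u} x"
    using assms by (intro closest_point_unique) (auto simp: dist_real_def)
  then show ?thesis by simp
qed

lemma myopic_price_antimono_radius:
  assumes "plo < phi" "0 < a" "0 < m + r" "r \<le> r'"
  shows "myopic_price plo phi a m r' \<le> myopic_price plo phi a m r"
proof -
  have "a / (2 * (m + r')) \<le> a / (2 * (m + r))"
    using assms by (intro divide_left_mono mult_pos_pos) auto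
  with assms(1) show ?thesis
    by (auto simp: myopic_price_def closest_point_interval_real)
qed

lemma myopic_price_ge_lower:
  assumes "plo < phi"
  shows "plo \<le> myopic_price plo phi a m r"
  using assms by (simp add: myopic_price_def closest_point_interval_real)

lemma myopic_price_interior:
  assumes "plo < phi" "plo \<le> a / (2 * (m + r))" "a / (2 * (m + r)) \<le> phi"
  shows "myopic_price plo phi a m r = a / (2 * (m + r))"
  using assms by (simp add: myopic_price_def closest_point_interval_real)

lemma fisher_info_mono:
  assumes "0 \<le> p" "p \<le> q"
  shows "fisher_info \<sigma> p \<le> fisher_info \<sigma> q"
  using assms by (simp add: fisher_info_def divide_right_mono power_mono)

lemma fisher_info_strict_mono:
  assumes "0 < \<sigma>\<^sup>2" "0 \<le> p" "p < q"
  shows "fisher_info \<sigma> p < fisher_info \<sigma> q"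
  using assms by (simp add: fisher_info_def divide_strict_right_mono power_strict_mono)

text \<open>
  The update in precision form, in which both of its monotonicity properties can be read off.
\<close>

lemma next_var_precision:
  assumes "0 < v"
  shows "next_var \<sigma> v p = 1 / (1 / v + fisher_info \<sigma> p)"
  using assms by (simp add: next_var_def fisher_info_def field_simps)

lemma fisher_info_nonneg: "0 \<le> fisher_info \<sigma> p"
  by (simp add: fisher_info_def)

lemma precision_pos: "0 < v \<Longrightarrow> 0 < 1 / v + fisher_info \<sigma> p"
  by (simp add: add_pos_nonneg fisher_info_nonneg)

lemma next_var_pos:
  assumes "0 < v"
  shows "0 < next_var \<sigma> v p"
  using precision_pos[OF assms] by (simp add: next_var_precision[OF assms])

lemma next_var_le:
  assumes "0 < v"
  shows "next_var \<sigma> v p \<le> v"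
proof -
  have "1 / (1 / v + fisher_info \<sigma> p) \<le> 1 / (1 / v)"
    using assms precision_pos[OF assms] fisher_info_nonneg
    by (intro divide_left_mono) (auto intro: mult_pos_pos)
  then show ?thesis by (simp add: next_var_precision[OF assms])
qed

lemma next_var_mono:
  assumes "0 < v" "v \<le> w" "fisher_info \<sigma> q \<le> fisher_info \<sigma> p"
  shows "next_var \<sigma> v p \<le> next_var \<sigma> w q"
proof -
  have w: "0 < w" using assms by simp
  have "1 / w \<le> 1 / v" using assms by (simp add: frac_le)
  then have "1 / (1 / v + fisher_info \<sigma> p) \<le> 1 / (1 / w + fisher_info \<sigma> q)"
    using precision_pos[OF w, of \<sigma> q] assms by (intro frac_le) auto
  then show ?thesis using assms w by (simp add: next_var_precision)
qed

lemma next_var_strict_mono: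
  assumes "0 < v" "v \<le> w" "fisher_info \<sigma> q < fisher_info \<sigma> p"
  shows "next_var \<sigma> v p < next_var \<sigma> w q"
proof -
  have w: "0 < w" using assms by simp
  have "1 / w \<le> 1 / v" using assms by (simp add: frac_le)
  then have "1 / (1 / v + fisher_info \<sigma> p) < 1 / (1 / w + fisher_info \<sigma> q)"
    using precision_pos[OF w, of \<sigma> q] assms by (intro frac_less2) auto
  then show ?thesis using assms w by (simp add: next_var_precision)
qed

section \<open>Comparison of the radii\<close>

lemma inherited_radius_mono:
  assumes "0 < z" "0 < vs" "v \<le> w"
  shows "inherited_radius z vs v \<le> inherited_radius z vs w"
  using assms by (simp add: inherited_radius_def divide_right_mono)

lemma inherited_radius_strict_mono:
  assumes "0 < z" "0 < vs" "v < w"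
  shows "inherited_radius z vs v < inherited_radius z vs w"
  using assms by (simp add: inherited_radius_def divide_strict_right_mono)

text \<open>
  The inherited radius is linear in the variance and meets the fresh one at \<open>v = vs\<close>; below that
  point the square root lies above its chord from the origin.
\<close>

lemma inherited_radius_le_fresh:
  assumes "0 < z" "0 < v" "v \<le> vs"
  shows "inherited_radius z vs v \<le> fresh_radius z v"
proof -
  have "v = sqrt v * sqrt v" using assms by simp
  also have "\<dots> \<le> sqrt v * sqrt vs" using assms by (intro mult_left_mono) auto
  finally have "v / sqrt vs \<le> sqrt v"
    using assms by (simp add: divide_le_eq)
  with assms(1) show ?thesis
    by (simp add: inherited_radius_def fresh_radius_def flip: times_divide_eq_right)
qed

section \<open>The comparison along a pair of conditional paths\<close>

context conditional_paths
begin

text \<open>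
  One step of the comparison.  The price ordering needs the variance ordering \<open>vI t \<le> vF t\<close> as
  well as \<open>vF t \<le> vs\<close>: the radii are compared through the inherited radius at the larger
  variance \<open>vF t\<close>.
\<close>

lemma price_le_if_ordered:
  assumes "s \<le> t" "0 < vI t" "vI t \<le> vF t" "vF t \<le> vs"
  shows "fresh_price plo phi a z (m t) (vF t) \<le> inherited_price plo phi a z vs (m t) (vI t)"
proof -
  have "inherited_radius z vs (vI t) \<le> inherited_radius z vs (vF t)"
    using assms z_pos vs_pos by (intro inherited_radius_mono)
  also have "\<dots> \<le> fresh_radius z (vF t)"
    using assms z_pos by (intro inherited_radius_le_fresh) auto
  finally have "inherited_radius z vs (vI t) \<le> fresh_radius z (vF t)" .
  moreover have "0 < m t + inherited_radius z vs (vI t)"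
    using denomI_pos assms(1) by force
  ultimately show ?thesis
    unfolding fresh_price_def inherited_price_def
    using price_bounds a_pos by (intro myopic_price_antimono_radius) auto
qed

lemma fresh_price_nonneg: "0 \<le> fresh_price plo phi a z (m t) v"
  using price_bounds myopic_price_ge_lower[of plo phi] unfolding fresh_price_def
  by (meson order_trans)

text \<open>
  The three bounds are proved together: ordering the next variances takes the price comparison at
  the current date, and that comparison rests on all three.
\<close>

lemma variances_ordered:
  assumes "s \<le> t"
  shows "0 < vI t \<and> vI t \<le> vF t \<and> vF t \<le> vs"
  using assms
proof (induction t rule: dec_induct)
  case base
  then show ?case using initF initI vs_pos by simp
next
  case (step t)
  then have ord: "0 < vI t" "vI t \<le> vF t" "vF t \<le> vs" by auto
  then have vF_pos: "0 < vF t" by simp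
  have "fisher_info \<sigma> (fresh_price plo phi a z (m t) (vF t))
      \<le> fisher_info \<sigma> (inherited_price plo phi a z vs (m t) (vI t))"
    using price_le_if_ordered[OF step.hyps(1) ord] fresh_price_nonneg by (intro fisher_info_mono)
  then have "vI (Suc t) \<le> vF (Suc t)"
    using recF recI step.hyps(1) ord by (simp add: next_var_mono)
  moreover have "0 < vI (Suc t)"
    using recI step.hyps(1) ord next_var_pos by simp
  moreover have "vF (Suc t) \<le> vs"
    using recF step.hyps(1) ord(3) next_var_le[OF vF_pos] by (metis order_trans)
  ultimately show ?case by simp
qed

lemma price_le:
  assumes "s \<le> t"
  shows "fresh_price plo phi a z (m t) (vF t) \<le> inherited_price plo phi a z vs (m t) (vI t)"
  using price_le_if_ordered variances_ordered assms by blast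

lemma info_le:
  assumes "s \<le> t"
  shows "fisher_info \<sigma> (fresh_price plo phi a z (m t) (vF t))
    \<le> fisher_info \<sigma> (inherited_price plo phi a z vs (m t) (vI t))"
  using price_le[OF assms] fresh_price_nonneg by (intro fisher_info_mono)

lemma price_gap_consequences:
  assumes t: "s \<le> t"
    and gap: "fresh_price plo phi a z (m t) (vF t) < inherited_price plo phi a z vs (m t) (vI t)"
  shows "vI (Suc t) < vF (Suc t)"
    and "fisher_info \<sigma> (fresh_price plo phi a z (m t) (vF t))
      < fisher_info \<sigma> (inherited_price plo phi a z vs (m t) (vI t))"
    and "inherited_radius z vs (vI (Suc t)) < fresh_radius z (vF (Suc t))"
proof -
  show info: "fisher_info \<sigma> (fresh_price plo phi a z (m t) (vF t))
      < fisher_info \<sigma> (inherited_price plo phi a z vs (m t) (vI t))"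
    using gap fresh_price_nonneg noise_var_pos by (intro fisher_info_strict_mono)
  show var: "vI (Suc t) < vF (Suc t)"
    using recF recI t variances_ordered[OF t] info by (simp add: next_var_strict_mono)
  have "inherited_radius z vs (vI (Suc t)) < inherited_radius z vs (vF (Suc t))"
    using var z_pos vs_pos by (intro inherited_radius_strict_mono)
  also have "\<dots> \<le> fresh_radius z (vF (Suc t))"
    using variances_ordered[of "Suc t"] t z_pos by (intro inherited_radius_le_fresh) auto
  finally show "inherited_radius z vs (vI (Suc t)) < fresh_radius z (vF (Suc t))" .
qed

end

section \<open>A path with a strict price gap\<close>

text \<open>
  With all of \<open>a\<close>, \<open>z\<close>, \<open>\<sigma>\<close>, the means and the initial variance equal to 1, the unconstrained
  price is at most 1/2, so the bounds 0 and 1 do not bind.  The common first price is 1/4, which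
  brings both variances down to 16/17.  At the next date the radii are \<open>sqrt (16/17)\<close> and
  \<open>16/17\<close>, and the first is larger.
\<close>

lemma strict_price_gap_exists:
  "\<exists>vF vI. conditional_paths 0 1 1 1 1 0 (\<lambda>_. 1) 1 vF vI \<and>
     fresh_price 0 1 1 1 1 (vF 1) < inherited_price 0 1 1 1 1 1 (vI 1)"
proof -
  define vF where "vF = rec_nat (1::real) (\<lambda>_ v. next_var 1 v (fresh_price 0 1 1 1 1 v))"
  define vI where "vI = rec_nat (1::real) (\<lambda>_ v. next_var 1 v (inherited_price 0 1 1 1 1 1 v))"
  have vF_pos: "0 < vF t" for t by (induction t) (simp_all add: vF_def next_var_pos)
  have vI_pos: "0 < vI t" for t by (induction t) (simp_all add: vI_def next_var_pos)
  have "conditional_paths 0 1 1 1 1 0 (\<lambda>_. 1) 1 vF vI"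
    by unfold_locales
      (use vF_pos vI_pos in \<open>auto simp: vF_def vI_def fresh_radius_def inherited_radius_def
         add_pos_nonneg less_imp_le\<close>)
  moreover have "fresh_price 0 1 1 1 1 (vF 1) < inherited_price 0 1 1 1 1 1 (vI 1)"
  proof -
    have first: "fresh_price 0 1 1 1 1 1 = 1/4" "inherited_price 0 1 1 1 1 1 1 = 1/4"
      by (simp_all add: fresh_price_def inherited_price_def fresh_radius_def inherited_radius_def
          myopic_price_interior)
    have v1: "vF 1 = 16/17" "vI 1 = 16/17"
      by (simp_all add: vF_def vI_def first next_var_def power2_eq_square)
    have root: "16/17 < sqrt (16/17)"
      by (rule real_less_rsqrt) (simp add: power2_eq_square)
    have "fresh_price 0 1 1 1 1 (16/17) = 1 / (2 * (1 + sqrt (16/17)))"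
      using myopic_price_interior[of 0 1 1 1 "sqrt (16/17)"] root
      by (simp add: fresh_price_def fresh_radius_def)
    also have "\<dots> < 1 / (2 * (1 + 16/17))"
      using root by (intro divide_strict_left_mono) auto
    also have "\<dots> = inherited_price 0 1 1 1 1 1 (16/17)"
      by (simp add: inherited_price_def inherited_radius_def myopic_price_interior)
    finally show ?thesis unfolding v1 .
  qed
  ultimately show ?thesis by blast
qed

section \<open>Fresh reconstruction against the inherited radius\<close>

theorem proposition9p2:
  fixes plo phi a z \<sigma> vs :: real
    and s :: nat
    and m vF vI :: "nat \<Rightarrow> real"
  assumes "conditional_paths plo phi a z \<sigma> s m vs vF vI"
  shows "(\<forall>t\<ge>s. vF t \<ge> vI t \<and>
            fresh_price plo phi a z (m t) (vF t) \<le> inherited_price plo phi a z vs (m t) (vI t) \<and>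
            fisher_info \<sigma> (fresh_price plo phi a z (m t) (vF t))
              \<le> fisher_info \<sigma> (inherited_price plo phi a z vs (m t) (vI t)))
       \<and> (\<forall>t\<ge>s. fresh_price plo phi a z (m t) (vF t) < inherited_price plo phi a z vs (m t) (vI t) \<longrightarrow>
            vF (Suc t) > vI (Suc t) \<and>
            fisher_info \<sigma> (fresh_price plo phi a z (m t) (vF t))
              < fisher_info \<sigma> (inherited_price plo phi a z vs (m t) (vI t)) \<and>
            fresh_radius z (vF (Suc t)) > inherited_radius z vs (vI (Suc t)))
       \<and> (\<exists>plo' phi' a' z' \<sigma>' s' m' vs' vF' vI'.
            conditional_paths plo' phi' a' z' \<sigma>' s' m' vs' vF' vI' \<and>
            (\<exists>t\<ge>s'.
              fresh_price plo' phi' a' z' (m' t) (vF' t)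
                < inherited_price plo' phi' a' z' vs' (m' t) (vI' t) \<and>
              fisher_info \<sigma>' (fresh_price plo' phi' a' z' (m' t) (vF' t))
                < fisher_info \<sigma>' (inherited_price plo' phi' a' z' vs' (m' t) (vI' t)) \<and>
              vF' (Suc t) > vI' (Suc t) \<and>
              fresh_radius z' (vF' (Suc t)) > inherited_radius z' vs' (vI' (Suc t))))"
proof (intro conjI)
  interpret conditional_paths plo phi a z \<sigma> s m vs vF vI by (fact assms)
  show "\<forall>t\<ge>s. vF t \<ge> vI t \<and>
      fresh_price plo phi a z (m t) (vF t) \<le> inherited_price plo phi a z vs (m t) (vI t) \<and>
      fisher_info \<sigma> (fresh_price plo phi a z (m t) (vF t))
        \<le> fisher_info \<sigma> (inherited_price plo phi a z vs (m t) (vI t))"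
    using variances_ordered price_le info_le by blast
  show "\<forall>t\<ge>s. fresh_price plo phi a z (m t) (vF t) < inherited_price plo phi a z vs (m t) (vI t) \<longrightarrow>
      vF (Suc t) > vI (Suc t) \<and>
      fisher_info \<sigma> (fresh_price plo phi a z (m t) (vF t))
        < fisher_info \<sigma> (inherited_price plo phi a z vs (m t) (vI t)) \<and>
      fresh_radius z (vF (Suc t)) > inherited_radius z vs (vI (Suc t))"
    using price_gap_consequences by blast
next
  obtain wF wI where paths: "conditional_paths 0 1 1 1 1 0 (\<lambda>_. 1) 1 wF wI"
    and gap: "fresh_price 0 1 1 1 1 (wF 1) < inherited_price 0 1 1 1 1 1 (wI 1)"
    using strict_price_gap_exists by blast
  show "\<exists>plo' phi' a' z' \<sigma>' s' m' vs' vF' vI'.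
      conditional_paths plo' phi' a' z' \<sigma>' s' m' vs' vF' vI' \<and>
      (\<exists>t\<ge>s'.
        fresh_price plo' phi' a' z' (m' t) (vF' t)
          < inherited_price plo' phi' a' z' vs' (m' t) (vI' t) \<and>
        fisher_info \<sigma>' (fresh_price plo' phi' a' z' (m' t) (vF' t))
          < fisher_info \<sigma>' (inherited_price plo' phi' a' z' vs' (m' t) (vI' t)) \<and>
        vF' (Suc t) > vI' (Suc t) \<and>
        fresh_radius z' (vF' (Suc t)) > inherited_radius z' vs' (vI' (Suc t)))"
    using paths gap conditional_paths.price_gap_consequences[OF paths, of 1] by blast
qed

end
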